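(* For every real number $a>0$, $$\Gamma(a+1)^2\le\bigl(\gamma(a,1)+\Gamma(a+2,1)\bigr)\cdot\bigl(\gamma(a+2,1)+\Gamma(a,1)\bigr)\le\Gamma(a+2)\cdot\Gamma(a).$$
   Context: For $a>0$ and $x>0$ the Euler gamma function and the upper and lower incomplete gamma functions are $$\Gamma(a)=\int_0^\infty t^{a-1}e^{-t}\,dt,\qquad \Gamma(a,x)=\int_x^\infty t^{a-1}e^{-t}\,dt,\qquad \gamma(a,x)=\int_0^x t^{a-1}e^{-t}\,dt.$$ *)

theory Defs
  imports "HOL-Analysis.Analysis"
begin

(* Both definitions are meant for a > 0 and x > 0. There the integrands are nonnegative and
   integrable (also in Lebesgue's sense), so the gauge integral is not the default value 0.
   For the complete function, Gamma is the library constant, whose Euler integral is the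
   library lemma Gamma_integral_real. *)

definition upper_incomplete_Gamma :: "real \<Rightarrow> real \<Rightarrow> real" where
  "upper_incomplete_Gamma a x = integral {x..} (\<lambda>t. t powr (a - 1) * exp (- t))"

definition lower_incomplete_Gamma :: "real \<Rightarrow> real \<Rightarrow> real" where
  "lower_incomplete_Gamma a x = integral {0..x} (\<lambda>t. t powr (a - 1) * exp (- t))"

end

theory Submission
  imports Defs
begin

text \<open>
  Write \<open>w t = t powr (a - 1) * exp (- t)\<close>, and let \<open>P\<close> and \<open>Q\<close> be the two factors of the product
  in the middle. Since \<open>t\<^sup>2 \<le> 1\<close> on \<open>[0, 1]\<close> and \<open>t\<^sup>2 \<ge> 1\<close> on \<open>[1, \<infinity>)\<close>, they are
  the integrals over \<open>[0, \<infinity>)\<close> of \<open>max 1 t\<^sup>2 * w t\<close> and \<open>min 1 t\<^sup>2 * w t\<close>.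

  Lower bound: as \<open>max 1 t\<^sup>2 * min 1 t\<^sup>2 = t\<^sup>2\<close>, this is the Cauchy--Schwarz inequality.
  It is obtained by integrating \<open>2 * l * t \<le> l\<^sup>2 * max 1 t\<^sup>2 + min 1 t\<^sup>2\<close>, separately on the two
  intervals (\<open>integral_moment_le\<close>), and choosing \<open>l = Gamma (a + 1) / P\<close>.

  Upper bound: splitting the complete functions at \<open>1\<close> (\<open>Gamma_eq_lower_plus_upper\<close>) gives
  the identity
  \<open>\<Gamma>(a+2) \<Gamma>(a) - P Q = (\<gamma>(a,1) - \<gamma>(a+2,1)) (\<Gamma>(a+2,1) - \<Gamma>(a,1))\<close>,
  whose factors on the right are nonnegative by monotonicity in the exponent.
\<close>

lemma Gamma_integrand_has_integral:
  fixes a :: real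
  assumes "a > 0"
  shows "((\<lambda>t. t powr (a - 1) * exp (- t)) has_integral Gamma a) {0..}"
  using Gamma_integral_real[OF assms] by (simp add: exp_minus field_simps)

lemma Gamma_integrand_integrable_on:
  fixes a :: real
  assumes "a > 0" and "S \<in> sets lebesgue" and "S \<subseteq> {0..}"
  shows "(\<lambda>t. t powr (a - 1) * exp (- t)) integrable_on S"
proof -
  have "(\<lambda>t. t powr (a - 1) * exp (- t)) absolutely_integrable_on {0..}"
    using Gamma_integrand_has_integral[OF assms(1)]
    by (intro nonnegative_absolutely_integrable_1) (auto simp: has_integral_integrable)
  then have "(\<lambda>t. t powr (a - 1) * exp (- t)) absolutely_integrable_on S"
    using assms(2,3) by (rule set_integrable_subset)
  then show ?thesis
    by (rule set_lebesgue_integral_eq_integral)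
qed

lemma Gamma_eq_lower_plus_upper:
  fixes a x :: real
  assumes "a > 0" and "x \<ge> 0"
  shows "Gamma a = lower_incomplete_Gamma a x + upper_incomplete_Gamma a x"
proof -
  let ?f = "\<lambda>t. t powr (a - 1) * exp (- t)"
  have int: "?f integrable_on {0..x}" "?f integrable_on {x..}"
    using assms by (auto intro!: Gamma_integrand_integrable_on)
  have union: "{0..x} \<union> {x..} = {0..}" and inter: "{0..x} \<inter> {x..} = {x}"
    using assms(2) by auto
  have "(?f has_integral integral {0..x} ?f + integral {x..} ?f) ({0..x} \<union> {x..})"
    using int by (intro has_integral_Un integrable_integral) (simp_all only: inter negligible_sing)
  then show ?thesis
    using Gamma_integrand_has_integral[OF assms(1)] has_integral_unique
    unfolding union lower_incomplete_Gamma_def upper_incomplete_Gamma_def by blast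
qed

text \<open>
  The weighted arithmetic--geometric mean inequality between the moments of order \<open>a\<close>, \<open>a + 1\<close> and
  \<open>a + 2\<close>. Having both weights \<open>l\<close> and \<open>m\<close> lets the moments of order \<open>a\<close> and \<open>a + 2\<close> exchange
  their roles.
\<close>

lemma integral_moment_le:
  fixes a l m :: real
  assumes "a > 0" and "S \<in> sets lebesgue" and "S \<subseteq> {0..}"
  defines "I \<equiv> \<lambda>b. integral S (\<lambda>t. t powr (b - 1) * exp (- t))"
  shows "2 * l * m * I (a + 1) \<le> l\<^sup>2 * I a + m\<^sup>2 * I (a + 2)"
proof -
  let ?f = "\<lambda>b t::real. t powr (b - 1) * exp (- t)"
  have has: "(?f b has_integral I b) S" if "b > 0" for b
    unfolding I_def
    using Gamma_integrand_integrable_on[OF that assms(2,3)] by (rule integrable_integral)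
  have "((\<lambda>t. (2 * l * m) * ?f (a + 1) t) has_integral (2 * l * m) * I (a + 1)) S"
    using assms(1) by (intro has_integral_mult_right has) auto
  moreover have "((\<lambda>t. l\<^sup>2 * ?f a t + m\<^sup>2 * ?f (a + 2) t) has_integral
      l\<^sup>2 * I a + m\<^sup>2 * I (a + 2)) S"
    using assms(1) by (intro has_integral_add has_integral_mult_right has) auto
  moreover have "(2 * l * m) * ?f (a + 1) t \<le> l\<^sup>2 * ?f a t + m\<^sup>2 * ?f (a + 2) t"
    if "t \<in> S" for t
  proof (cases "t = 0")
    case False
    with that assms(3) have "t > 0" by force
    then have 1: "t powr (a + 1 - 1) = t * t powr (a - 1)"
      using powr_add[of t 1 "a - 1"] by (simp add: algebra_simps)
    have 2: "t powr (a + 2 - 1) = t\<^sup>2 * t powr (a - 1)"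
      using \<open>t > 0\<close> powr_add[of t 2 "a - 1"] by (simp add: algebra_simps)
    have "0 \<le> (l - m * t)\<^sup>2 * ?f a t"
      by simp
    then show ?thesis
      unfolding 1 2 by (simp add: power2_eq_square algebra_simps)
  qed simp
  ultimately show ?thesis
    by (rule has_integral_le)
qed

lemma lower_incomplete_Gamma_antimono:
  fixes a b :: real
  assumes "0 < a" and "a \<le> b"
  shows "lower_incomplete_Gamma b 1 \<le> lower_incomplete_Gamma a 1"
  unfolding lower_incomplete_Gamma_def
  using assms by (intro integral_le Gamma_integrand_integrable_on mult_right_mono powr_mono') auto

lemma upper_incomplete_Gamma_mono:
  fixes a b :: real
  assumes "0 < a" and "a \<le> b"
  shows "upper_incomplete_Gamma a 1 \<le> upper_incomplete_Gamma b 1"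
  unfolding upper_incomplete_Gamma_def
  using assms by (intro integral_le Gamma_integrand_integrable_on mult_right_mono powr_mono) auto

theorem mainTheorem4:
  fixes a :: real
  assumes "a > 0"
  shows "(Gamma (a + 1))\<^sup>2
           \<le> (lower_incomplete_Gamma a 1 + upper_incomplete_Gamma (a + 2) 1)
              * (lower_incomplete_Gamma (a + 2) 1 + upper_incomplete_Gamma a 1)
       \<and> (lower_incomplete_Gamma a 1 + upper_incomplete_Gamma (a + 2) 1)
              * (lower_incomplete_Gamma (a + 2) 1 + upper_incomplete_Gamma a 1)
           \<le> Gamma (a + 2) * Gamma a"
proof -
  define P where "P = lower_incomplete_Gamma a 1 + upper_incomplete_Gamma (a + 2) 1"
  define Q where "Q = lower_incomplete_Gamma (a + 2) 1 + upper_incomplete_Gamma a 1"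
  have split: "Gamma b = lower_incomplete_Gamma b 1 + upper_incomplete_Gamma b 1" if "b > 0" for b
    using that by (rule Gamma_eq_lower_plus_upper) simp
  have lower: "lower_incomplete_Gamma (a + 2) 1 \<le> lower_incomplete_Gamma a 1"
    and upper: "upper_incomplete_Gamma a 1 \<le> upper_incomplete_Gamma (a + 2) 1"
    using assms by (simp_all add: lower_incomplete_Gamma_antimono upper_incomplete_Gamma_mono)
  have "P > 0"
    using split[OF assms] upper Gamma_real_pos[OF assms] by (simp add: P_def)
  \<comment> \<open>The weight that maximises \<open>2 * l * Gamma (a + 1) - l\<^sup>2 * P\<close>.\<close>
  define l where "l = Gamma (a + 1) / P"
  have "2 * l * lower_incomplete_Gamma (a + 1) 1
      \<le> l\<^sup>2 * lower_incomplete_Gamma a 1 + lower_incomplete_Gamma (a + 2) 1"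
    using integral_moment_le[of a "{0..1}" l 1] assms by (simp add: lower_incomplete_Gamma_def)
  moreover have "2 * l * upper_incomplete_Gamma (a + 1) 1
      \<le> upper_incomplete_Gamma a 1 + l\<^sup>2 * upper_incomplete_Gamma (a + 2) 1"
    using integral_moment_le[of a "{1..}" 1 l] assms by (simp add: upper_incomplete_Gamma_def)
  ultimately have "2 * l * Gamma (a + 1) \<le> l\<^sup>2 * P + Q"
    using split[of "a + 1"] assms by (simp add: P_def Q_def algebra_simps)
  then have "(Gamma (a + 1))\<^sup>2 \<le> P * Q"
    using \<open>P > 0\<close> by (simp add: l_def power2_eq_square field_simps)
  moreover have "P * Q \<le> Gamma (a + 2) * Gamma a"
  proof -
    have "Gamma (a + 2) * Gamma a - P * Q
        = (lower_incomplete_Gamma a 1 - lower_incomplete_Gamma (a + 2) 1)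
          * (upper_incomplete_Gamma (a + 2) 1 - upper_incomplete_Gamma a 1)"
      using split[of a] split[of "a + 2"] assms by (simp add: P_def Q_def algebra_simps)
    also have "\<dots> \<ge> 0"
      using lower upper by simp
    finally show ?thesis by simp
  qed
  ultimately show ?thesis
    by (simp add: P_def Q_def)
qed

end
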